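(* Let $r\ge1$, $\ell\ge1$, and for $i,j\in\mathbb{Z}$ let $k^{(0)}_{i,j}\in\{0,1\}$ be the residue of $i+j$ mod $2$; let $t_{i,j}$ be formal variables. (a) (Right half-space.) Let $T_{i,j,k}$, for $i\in[0,r+1]$, $j\ge0$, $k\in\mathbb{Z}$, $i+j+k$ even, solve $$T_{i,j,k+1}T_{i,j,k-1}=T_{i,j+1,k}T_{i,j-1,k}+T_{i+1,j,k}T_{i-1,j,k}\quad(i\in[1,r],\ j\ge1,\ k\in\mathbb{Z})$$ with $T_{0,j,k}=T_{r+1,j,k}=1$, $T_{i,0,k}=1$, and initial conditions $T_{i,j,k^{(0)}_{i,j}}=t_{i,j}$ for $i\in[1,r]$, $j\ge1$. Then each $T_{i,j,k}$ is a Laurent polynomial in $\{t_{i,j}\}_{i\in[1,r],j\ge1}$ with non-negative integer coefficients. (b) (Left half-space.) Let $T_{i,j,k}$, for $i\in[0,r+1]$, $j\le\ell+1$, $k\in\mathbb{Z}$, $i+j+k$ even, solve the same relation for $i\in[1,r]$, $j\le\ell$, $k\in\mathbb{Z}$, with $T_{0,j,k}=T_{r+1,j,k}=1$, $T_{i,\ell+1,k}=1$, and initial conditions $T_{i,j,k^{(0)}_{i,j}}=t_{i,j}$ for $i\in[1,r]$, $j\le\ell$. Then each $T_{i,j,k}$ is a Laurent polynomial in $\{t_{i,j}\}_{i\in[1,r],j\le\ell}$ with non-negative integer coefficients.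
   Context: Each system is a three-term recursion in $k$, so the initial values determine the solution uniquely as rational functions of the $t_{i,j}$. *)

theory Defs
  imports
    "HOL-Library.Poly_Mapping"
    "HOL-Library.Product_Lexorder"
    "HOL-Computational_Algebra.Fraction_Field"
begin

text \<open>
  The variables \<open>t i j\<close> are indexed by all pairs of integers.  Polynomials with integer
  coefficients are finitely supported maps from exponent vectors to integers, and rational
  functions are their fractions.  The lexicographic order on the index pairs is only needed for
  the type-class instance making the polynomial ring an integral domain.
\<close>

type_synonym int_mpoly = "((int \<times> int) \<Rightarrow>\<^sub>0 nat) \<Rightarrow>\<^sub>0 int"

type_synonym ratfun = "int_mpoly fract"

definition tvar :: "int \<Rightarrow> int \<Rightarrow> ratfun" where
  "tvar i j = Fract (Poly_Mapping.single (Poly_Mapping.single (i, j) 1) 1) 1"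

definition laurent_monom :: "((int \<times> int) \<Rightarrow>\<^sub>0 int) \<Rightarrow> ratfun" where
  "laurent_monom e = (\<Prod>(i, j)\<in>Poly_Mapping.keys e. tvar i j powi Poly_Mapping.lookup e (i, j))"

definition nonneg_laurent_poly :: "(int \<times> int) set \<Rightarrow> ratfun \<Rightarrow> bool" where
  "nonneg_laurent_poly V f \<longleftrightarrow>
     (\<exists>c :: ((int \<times> int) \<Rightarrow>\<^sub>0 int) \<Rightarrow>\<^sub>0 int.
        (\<forall>e\<in>Poly_Mapping.keys c. Poly_Mapping.keys e \<subseteq> V) \<and>
        (\<forall>e. 0 \<le> Poly_Mapping.lookup c e) \<and>
        f = (\<Sum>e\<in>Poly_Mapping.keys c. of_int (Poly_Mapping.lookup c e) * laurent_monom e))"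

definition k0 :: "int \<Rightarrow> int \<Rightarrow> int" where
  "k0 i j = (i + j) mod 2"

text \<open>
  The unknowns \<open>T i j k\<close> exist only for even \<open>i + j + k\<close>.  Values at odd \<open>i + j + k\<close> are
  junk values of a total function and are left unconstrained; accordingly the recursion at
  \<open>(i, j, k)\<close>, whose terms all sit at lattice neighbours, is imposed for odd \<open>i + j + k\<close>.
\<close>

definition T_relation :: "(int \<Rightarrow> int \<Rightarrow> int \<Rightarrow> 'a::field) \<Rightarrow> int \<Rightarrow> int \<Rightarrow> int \<Rightarrow> bool" where
  "T_relation T i j k \<longleftrightarrow>
     T i j (k + 1) * T i j (k - 1) = T i (j + 1) k * T i (j - 1) k + T (i + 1) j k * T (i - 1) j k"

definition right_half_space_solution :: "int \<Rightarrow> (int \<Rightarrow> int \<Rightarrow> int \<Rightarrow> ratfun) \<Rightarrow> bool" where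
  "right_half_space_solution r T \<longleftrightarrow>
     (\<forall>i\<in>{1..r}. \<forall>j\<ge>1. \<forall>k. odd (i + j + k) \<longrightarrow> T_relation T i j k) \<and>
     (\<forall>j\<ge>0. \<forall>k. even (0 + j + k) \<longrightarrow> T 0 j k = 1) \<and>
     (\<forall>j\<ge>0. \<forall>k. even (r + 1 + j + k) \<longrightarrow> T (r + 1) j k = 1) \<and>
     (\<forall>i\<in>{0..r + 1}. \<forall>k. even (i + 0 + k) \<longrightarrow> T i 0 k = 1) \<and>
     (\<forall>i\<in>{1..r}. \<forall>j\<ge>1. T i j (k0 i j) = tvar i j)"

definition left_half_space_solution :: "int \<Rightarrow> int \<Rightarrow> (int \<Rightarrow> int \<Rightarrow> int \<Rightarrow> ratfun) \<Rightarrow> bool" where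
  "left_half_space_solution r l T \<longleftrightarrow>
     (\<forall>i\<in>{1..r}. \<forall>j\<le>l. \<forall>k. odd (i + j + k) \<longrightarrow> T_relation T i j k) \<and>
     (\<forall>j\<le>l + 1. \<forall>k. even (0 + j + k) \<longrightarrow> T 0 j k = 1) \<and>
     (\<forall>j\<le>l + 1. \<forall>k. even (r + 1 + j + k) \<longrightarrow> T (r + 1) j k = 1) \<and>
     (\<forall>i\<in>{0..r + 1}. \<forall>k. even (i + (l + 1) + k) \<longrightarrow> T i (l + 1) k = 1) \<and>
     (\<forall>i\<in>{1..r}. \<forall>j\<le>l. T i j (k0 i j) = tvar i j)"

end

theory Submission
  imports Defs
begin

text \<open>
  Think of a multivector in an \<open>(r + 1)\<close>-dimensional space, written in a frame attached to each
  zigzag column of lattice points.  Moving one lattice point of the column changes two neighbouring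
  frame vectors by a unimodular \<open>2 \<times> 2\<close> matrix whose entries are monomials in the values of \<open>T\<close>
  with coefficient one, and the T-relation says exactly that this connection is flat.
  A multivector starts at the right end of the initial surface as the basis element of the block
  \<open>{1..i}\<close> and stays that basis element along the line where \<open>j + k\<close> is constant, up to the
  target point \<open>(i, j, k)\<close>.  Along the line where \<open>k - j\<close> is constant the product of \<open>T\<close> with the
  coefficient of \<open>{1..i}\<close> is conserved.  If that line meets the initial surface, \<open>T i j k\<close> is an
  initial value times a coefficient obtained by non-negative moves along the initial surface.
  If it meets the wall first, the coefficients at consecutive wall heights agree after a
  permutation of the frame indices; descending along the wall one reaches either the initial
  surface or the block \<open>{r + 2 - i..r + 1}\<close>, whose coefficient is constant along the line back to
  the initial surface.  Heights below the initial surface follow by the symmetry \<open>k \<mapsto> - k\<close>, and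
  the left half-space by \<open>j \<mapsto> l + 1 - j\<close>.
\<close>

section \<open>Local moves on multivector coefficients\<close>

text \<open>
  A subset of frame indices is a predicate \<open>I\<close>, and \<open>F I\<close> is the coefficient of the corresponding
  basis multivector.  Unimodularity of the matrix is what makes \<open>site_op\<close> act trivially when
  both or neither of \<open>s\<close>, \<open>s + 1\<close> belong to \<open>I\<close>.
\<close>

type_synonym 'a mat2 = "'a \<times> 'a \<times> 'a \<times> 'a"

definition swap_bits :: "int \<Rightarrow> (int \<Rightarrow> bool) \<Rightarrow> int \<Rightarrow> bool" where
  "swap_bits s I = I(s := I (s + 1), s + 1 := I s)"

fun site_op :: "int \<Rightarrow> 'a::field mat2 \<Rightarrow> ((int \<Rightarrow> bool) \<Rightarrow> 'a) \<Rightarrow> (int \<Rightarrow> bool) \<Rightarrow> 'a" where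
  "site_op s (a, b, c, d) F I =
     (if I s \<and> \<not> I (s + 1) then a * F I + b * F (swap_bits s I)
      else if \<not> I s \<and> I (s + 1) then c * F (swap_bits s I) + d * F I
      else F I)"

fun mult2 :: "'a::field mat2 \<Rightarrow> 'a mat2 \<Rightarrow> 'a mat2" where
  "mult2 (a, b, c, d) (a', b', c', d') =
     (a * a' + b * c', a * b' + b * d', c * a' + d * c', c * b' + d * d')"

abbreviation unit2 :: "'a::field mat2" where
  "unit2 \<equiv> (1, 0, 0, 1)"

fun sweep :: "int list \<Rightarrow> (int \<Rightarrow> 'a::field mat2) \<Rightarrow> ((int \<Rightarrow> bool) \<Rightarrow> 'a) \<Rightarrow> (int \<Rightarrow> bool) \<Rightarrow> 'a" where
  "sweep [] A F = F"
| "sweep (s # ss) A F = site_op s (A s) (sweep ss A F)"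

declare site_op.simps [simp del]

lemma swap_bits_apply:
  "swap_bits s I t = (if t = s then I (s + 1) else if t = s + 1 then I s else I t)"
  by (simp add: swap_bits_def)

lemma swap_bits_swap_bits [simp]: "swap_bits s (swap_bits s I) = I"
  by (auto simp: swap_bits_def fun_eq_iff)

lemma swap_bits_commute:
  "s + 1 < t \<Longrightarrow> swap_bits s (swap_bits t I) = swap_bits t (swap_bits s I)"
  by (auto simp: swap_bits_def fun_eq_iff)

lemma site_op_unit2 [simp]: "site_op s unit2 F = F"
  by (rule ext) (simp add: site_op.simps)

lemma site_op_mult2: "site_op s A (site_op s B F) = site_op s (mult2 A B) F"
  by (cases A; cases B; rule ext) (simp add: site_op.simps swap_bits_apply algebra_simps)

lemma site_op_commute_far:
  assumes "s + 1 < t"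
  shows "site_op s A (site_op t B F) = site_op t B (site_op s A F)"
  using assms
  by (cases A; cases B; intro ext)
     (simp add: site_op.simps swap_bits_apply swap_bits_commute[OF assms] algebra_simps)

lemma site_op_commute:
  assumes "s \<noteq> t" and "\<bar>s - t\<bar> = 1 \<Longrightarrow> A = unit2 \<or> B = unit2"
  shows "site_op s A (site_op t B F) = site_op t B (site_op s A F)"
proof -
  consider "s + 1 < t" | "t + 1 < s" | "\<bar>s - t\<bar> = 1"
    using assms(1) by linarith
  then show ?thesis
  proof cases
    case 1
    then show ?thesis by (rule site_op_commute_far)
  next
    case 2
    then show ?thesis by (rule site_op_commute_far[symmetric])
  qed (use assms(2) in auto)
qed

lemma sweep_cong: "(\<And>s. s \<in> set ss \<Longrightarrow> A s = B s) \<Longrightarrow> sweep ss A F = sweep ss B F"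
  by (induction ss) auto

lemma site_op_sweep_commute:
  assumes "t \<notin> set ss" and "\<And>s. s \<in> set ss \<Longrightarrow> \<bar>t - s\<bar> = 1 \<Longrightarrow> B = unit2 \<or> A s = unit2"
  shows "site_op t B (sweep ss A F) = sweep ss A (site_op t B F)"
  using assms
proof (induction ss)
  case (Cons a ss)
  have "site_op t B (site_op a (A a) (sweep ss A F)) = site_op a (A a) (site_op t B (sweep ss A F))"
    using Cons.prems by (intro site_op_commute) auto
  then show ?case using Cons by simp
qed simp

text \<open>Nontrivial matrices of the two families at different sites are never adjacent, by
  parity, so they commute and the sweeps multiply site by site.\<close>

lemma sweep_sweep:
  assumes "distinct ss"
    and "\<And>s. odd (s + q) \<Longrightarrow> A s = unit2" and "\<And>s. odd (s + q) \<Longrightarrow> B s = unit2"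
  shows "sweep ss A (sweep ss B F) = sweep ss (\<lambda>s. mult2 (A s) (B s)) F"
  using assms(1)
proof (induction ss)
  case (Cons a ss)
  have par: "A s = unit2 \<or> B a = unit2" if "\<bar>a - s\<bar> = 1" for s
  proof -
    have "s = a + 1 \<or> s = a - 1" using that by linarith
    then have "odd (s + q) \<or> odd (a + q)" by presburger
    then show ?thesis using assms(2,3) by blast
  qed
  have "sweep ss A (site_op a (B a) (sweep ss B F)) = site_op a (B a) (sweep ss A (sweep ss B F))"
    using Cons.prems par by (intro site_op_sweep_commute[symmetric]) auto
  then show ?case using Cons by (simp add: site_op_mult2)
qed simp

text \<open>The elementary matrices E(s, s + 1) and E(t + 1, t) commute for distinct sites. Only the
  diagonal part of the matrix at \<open>t\<close> interacts with the shear, and it rescales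
  \<open>c\<close> by the same factor on either side.\<close>

lemma site_op_shear_commute:
  assumes "\<bar>t - s\<bar> = 1" and "\<rho> \<noteq> 0"
  shows "site_op s (1, c, 0, 1) (site_op t (\<rho>, 0, 1, 1 / \<rho>) F) =
         site_op t (\<rho>, 0, 1, 1 / \<rho>) (site_op s (1, c * \<rho>, 0, 1) F)"
proof -
  have "t = s + 1 \<or> s = t + 1" using assms(1) by linarith
  then show ?thesis
  proof
    assume t: "t = s + 1"
    show ?thesis unfolding t
    proof (rule ext, goal_cases)
      case (1 I)
      show ?case
        by (cases "I s"; cases "I (s + 1)"; cases "I (s + 2)")
           (simp_all add: site_op.simps swap_bits_apply field_simps assms(2))
    qed
  next
    assume t: "s = t + 1"
    show ?thesis unfolding t
    proof (rule ext, goal_cases)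
      case (1 I)
      show ?case
        by (cases "I t"; cases "I (t + 1)"; cases "I (t + 2)")
           (simp_all add: site_op.simps swap_bits_apply field_simps assms(2))
    qed
  qed
qed


lemma site_op_sweep_shear_commute:
  assumes "distinct ss" and "B s = unit2"
    and "\<And>t. t \<in> set ss \<Longrightarrow> \<bar>t - s\<bar> = 1 \<Longrightarrow> \<rho> t \<noteq> 0 \<and> B t = (\<rho> t, 0, 1, 1 / \<rho> t)"
  shows "site_op s (1, c, 0, 1) (sweep ss B F) =
         sweep ss B (site_op s (1, c * (\<Prod>t\<in>set ss. if \<bar>t - s\<bar> = 1 then \<rho> t else 1), 0, 1) F)"
  using assms(1,3)
proof (induction ss arbitrary: c)
  case (Cons a ss)
  define w where "w = (if \<bar>a - s\<bar> = 1 then \<rho> a else 1)"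
  have "site_op s (1, c, 0, 1) (site_op a (B a) G) = site_op a (B a) (site_op s (1, c * w, 0, 1) G)" for G
  proof (cases "\<bar>a - s\<bar> = 1")
    case True
    then have "\<rho> a \<noteq> 0" "B a = (\<rho> a, 0, 1, 1 / \<rho> a)" using Cons.prems(2)[of a] by auto
    then show ?thesis using True by (simp add: w_def site_op_shear_commute)
  next
    case False
    show ?thesis
    proof (cases "a = s")
      case True
      then show ?thesis using assms(2) by (simp add: w_def)
    next
      case neq: False
      show ?thesis
        unfolding w_def using False neq
        by (subst site_op_commute) auto
    qed
  qed
  moreover have "site_op s (1, c * w, 0, 1) (sweep ss B F) =
    sweep ss B (site_op s (1, c * w * (\<Prod>t\<in>set ss. if \<bar>t - s\<bar> = 1 then \<rho> t else 1), 0, 1) F)"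
    using Cons by simp
  moreover have "c * w * (\<Prod>t\<in>set ss. if \<bar>t - s\<bar> = 1 then \<rho> t else 1) =
      c * (\<Prod>t\<in>set (a # ss). if \<bar>t - s\<bar> = 1 then \<rho> t else 1)"
    using Cons.prems(1) by (simp add: w_def)
  ultimately show ?case
    by simp
qed simp

text \<open>The first hypothesis excludes the index sets for which the row \<open>(c s, d s)\<close>
  would be read; the row (0, 1) merely swaps bits. Sites in \<open>C\<close> are not adjacent, so
  earlier swaps preserve this hypothesis.\<close>

lemma sweep_swap:
  assumes "\<And>s. s \<in> set ss \<Longrightarrow> C s \<Longrightarrow> I (s + 1) \<Longrightarrow> I s"
    and "distinct ss" and "\<And>s. \<not> (C s \<and> C (s + 1))"
    and "\<And>s. \<not> C s \<Longrightarrow> A s = unit2" and "\<And>s. C s \<Longrightarrow> A s = (0, 1, c s, d s)"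
  shows "sweep ss A F I =
    F (\<lambda>t. if t \<in> set ss \<and> C t then I (t + 1) else if t - 1 \<in> set ss \<and> C (t - 1) then I (t - 1) else I t)"
  using assms(1,2)
proof (induction ss arbitrary: I)
  case (Cons a ss)
  show ?case
  proof (cases "C a")
    case False
    have "sweep (a # ss) A F I = sweep ss A F I"
      using assms(4)[OF False] by (simp)
    also have "\<dots> = F (\<lambda>t. if t \<in> set ss \<and> C t then I (t + 1) else
        if t - 1 \<in> set ss \<and> C (t - 1) then I (t - 1) else I t)"
      using Cons by (intro Cons.IH) auto
    also have "\<dots> = F (\<lambda>t. if t \<in> set (a # ss) \<and> C t then I (t + 1) else
        if t - 1 \<in> set (a # ss) \<and> C (t - 1) then I (t - 1) else I t)"
      using False by (intro arg_cong[where f = F] ext) auto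
    finally show ?thesis .
  next
    case True
    have nb: "\<not> C (a + 1)" "\<not> C (a - 1)"
      using assms(3)[of a] assms(3)[of "a - 1"] True by auto
    have "sweep (a # ss) A F I = sweep ss A F (swap_bits a I)"
    proof (cases "I a = I (a + 1)")
      case eq: True
      then have "swap_bits a I = I" by (auto simp: swap_bits_def fun_eq_iff)
      then show ?thesis using eq assms(5)[OF True] by (simp add: site_op.simps)
    next
      case False
      then show ?thesis using Cons.prems(1)[of a] True assms(5)[OF True] by (auto simp: site_op.simps)
    qed
    also have "\<dots> = F (\<lambda>t. if t \<in> set ss \<and> C t then swap_bits a I (t + 1) else
        if t - 1 \<in> set ss \<and> C (t - 1) then swap_bits a I (t - 1) else swap_bits a I t)"
    proof (rule Cons.IH)
      fix s assume s: "s \<in> set ss" "C s" "swap_bits a I (s + 1)"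
      then have "s \<noteq> a" "s \<noteq> a + 1" "s + 1 \<noteq> a" using Cons.prems(2) nb by auto
      then show "swap_bits a I s" using s Cons.prems(1)[of s] by (auto simp: swap_bits_apply)
    qed (use Cons.prems in auto)
    also have "\<dots> = F (\<lambda>t. if t \<in> set (a # ss) \<and> C t then I (t + 1) else
        if t - 1 \<in> set (a # ss) \<and> C (t - 1) then I (t - 1) else I t)"
    proof (intro arg_cong[where f = F] ext, goal_cases)
      case (1 t)
      consider "t = a" | "t = a + 1" | "t = a - 1" | "t \<noteq> a" "t \<noteq> a + 1" "t \<noteq> a - 1" by auto
      then show ?case
        using nb True Cons.prems(2) assms(3)[of a] assms(3)[of "t - 1"]
        by cases (auto simp: swap_bits_apply add.commute)
    qed
    finally show ?thesis .
  qed
qed simp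

section \<open>The half-space system over an abstract semiring\<close>

locale half_space_system =
  fixes N :: int and T :: "int \<Rightarrow> int \<Rightarrow> int \<Rightarrow> 'a::field"
  assumes N: "2 \<le> N"
    and rel: "\<And>s j k. 1 \<le> s \<Longrightarrow> s < N \<Longrightarrow> 1 \<le> j \<Longrightarrow> odd (s + j + k) \<Longrightarrow> T_relation T s j k"
    and T_bottom: "\<And>j k. 0 \<le> j \<Longrightarrow> even (j + k) \<Longrightarrow> T 0 j k = 1"
    and T_top: "\<And>j k. 0 \<le> j \<Longrightarrow> even (N + j + k) \<Longrightarrow> T N j k = 1"
    and T_wall: "\<And>s k. 0 \<le> s \<Longrightarrow> s \<le> N \<Longrightarrow> even (s + k) \<Longrightarrow> T s 0 k = 1"
begin

lemma reflect: "half_space_system N (\<lambda>s j k. T s j (- k))"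
proof
  fix s j k :: int assume "1 \<le> s" "s < N" "1 \<le> j" "odd (s + j + k)"
  then have "T_relation T s j (- k)" by (intro rel) auto
  then show "T_relation (\<lambda>s j k. T s j (- k)) s j k"
    by (simp add: T_relation_def mult.commute[of "T s j (- k - 1)"])
qed (use N in \<open>auto intro: T_bottom T_top T_wall\<close>)

text \<open>Serves to show that \<open>T\<close> does not vanish, as the matrices have values of
  \<open>T\<close> in denominators. The recursion solved for its highest value is subtraction-free,
  and \<open>Q\<close> omits 0.\<close>

lemma T_in_semifield_above:
  assumes Q: "1 \<in> Q" "\<And>x y. x \<in> Q \<Longrightarrow> y \<in> Q \<Longrightarrow> x + y \<in> Q" "\<And>x y. x \<in> Q \<Longrightarrow> y \<in> Q \<Longrightarrow> x * y \<in> Q"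
      "\<And>x y. x \<in> Q \<Longrightarrow> y \<in> Q \<Longrightarrow> x / y \<in> Q" "0 \<notin> Q"
    and init: "\<And>s j k. 1 \<le> s \<Longrightarrow> s < N \<Longrightarrow> 1 \<le> j \<Longrightarrow> even (s + j + k) \<Longrightarrow> k = m \<or> k = m + 1 \<Longrightarrow> T s j k \<in> Q"
    and "0 \<le> s" "s \<le> N" "0 \<le> j" "even (s + j + k)" "m \<le> k"
  shows "T s j k \<in> Q"
proof -
  have bd: "T s j k \<in> Q"
    if "0 \<le> s" "s \<le> N" "0 \<le> j" "even (s + j + k)" "s = 0 \<or> s = N \<or> j = 0" for s j k
  proof -
    have "T s j k = 1"
      using that T_bottom[of j k] T_top[of j k] T_wall[of s k] by fastforce
    then show ?thesis using Q(1) by simp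
  qed
  have "T s j k \<in> Q"
    if "0 \<le> s" "s \<le> N" "0 \<le> j" "even (s + j + k)" "k = m + int n \<or> k = m + int n + 1" for s j k n
    using that
  proof (induction n arbitrary: s j k)
    case 0
    then show ?case using init[of s j k] bd[of s j k] by fastforce
  next
    case (Suc n)
    consider "k = m + int n + 1" | "k = m + int n + 2" "s = 0 \<or> s = N \<or> j = 0"
      | "k = m + int n + 2" "1 \<le> s" "s < N" "1 \<le> j"
      using Suc.prems by force
    then show ?case
    proof cases
      case 1
      then show ?thesis using Suc by blast
    next
      case 2
      then show ?thesis using Suc.prems bd by blast
    next
      case 3
      have par: "odd (s + j + (k - 1))" using Suc.prems by presburger
      have mem: "T s j (k - 2) \<in> Q" "T s (j + 1) (k - 1) \<in> Q" "T s (j - 1) (k - 1) \<in> Q"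
          "T (s + 1) j (k - 1) \<in> Q" "T (s - 1) j (k - 1) \<in> Q"
        by (rule Suc.IH; use 3 par in presburger)+
      have "T_relation T s j (k - 1)" using 3 par by (intro rel) auto
      then have "T s j k * T s j (k - 2) =
          T s (j + 1) (k - 1) * T s (j - 1) (k - 1) + T (s + 1) j (k - 1) * T (s - 1) j (k - 1)"
        by (simp add: T_relation_def)
      moreover have "T s j (k - 2) \<noteq> 0" using mem(1) Q(5) by auto
      ultimately have "T s j k = (T s (j + 1) (k - 1) * T s (j - 1) (k - 1) +
          T (s + 1) j (k - 1) * T (s - 1) j (k - 1)) / T s j (k - 2)"
        by (simp add: field_simps)
      then show ?thesis using mem Q by simp
    qed
  qed
  from this[of s j k "nat (k - m)"] show ?thesis using assms by simp
qed

end

text \<open>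
  The initial surface occupies the heights \<open>m\<close> and \<open>m + 1\<close>, and \<open>P\<close> plays the role of the
  semiring of non-negative Laurent polynomials.
\<close>

locale half_space = half_space_system N T
  for N :: int and T :: "int \<Rightarrow> int \<Rightarrow> int \<Rightarrow> 'a::field" +
  fixes m :: int and P :: "'a set"
  assumes T_nonzero: "\<And>s j k. 0 \<le> s \<Longrightarrow> s \<le> N \<Longrightarrow> 0 \<le> j \<Longrightarrow> even (s + j + k) \<Longrightarrow> T s j k \<noteq> 0"
    and P_zero: "0 \<in> P" and P_one: "1 \<in> P"
    and P_add: "\<And>x y. x \<in> P \<Longrightarrow> y \<in> P \<Longrightarrow> x + y \<in> P"
    and P_mult: "\<And>x y. x \<in> P \<Longrightarrow> y \<in> P \<Longrightarrow> x * y \<in> P"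
    and init: "\<And>s j k. 1 \<le> s \<Longrightarrow> s < N \<Longrightarrow> 1 \<le> j \<Longrightarrow> even (s + j + k) \<Longrightarrow> k = m \<or> k = m + 1 \<Longrightarrow>
        T s j k \<in> P \<and> inverse (T s j k) \<in> P"
begin

section \<open>The flat connection and its exchange relations\<close>

text \<open>
  The column \<open>(j, k)\<close> consists of the lattice points in column \<open>j\<close> at heights \<open>k\<close> and \<open>k + 1\<close>,
  and the row \<open>(j, k)\<close> of those at height \<open>k\<close> in columns \<open>j\<close> and \<open>j + 1\<close>.  The moves lead
  \<^item> from row \<open>(j, k + 1)\<close> to column \<open>(j, k)\<close>, and from column \<open>(j + 1, k)\<close> to row \<open>(j, k)\<close>,
    by \<open>stepY j k\<close>;
  \<^item> from column \<open>(j + 1, k)\<close> to row \<open>(j, k + 1)\<close> by \<open>stepXA j k\<close>;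
  \<^item> from row \<open>(j, k)\<close> to column \<open>(j, k)\<close> by \<open>stepXB j k\<close>.
\<close>

definition ratio :: "int \<Rightarrow> int \<Rightarrow> int \<Rightarrow> 'a" where
  "ratio j k s = T s (j + 1) (k + 1) / T s j k"

definition stepY :: "int \<Rightarrow> int \<Rightarrow> int \<Rightarrow> 'a mat2" where
  "stepY j k s = (if even (s + j + k) then (ratio j k s, 0, 1, 1 / ratio j k s) else unit2)"

definition stepXA :: "int \<Rightarrow> int \<Rightarrow> int \<Rightarrow> 'a mat2" where
  "stepXA j k s = (if odd (s + j + k) then
     (1, T (s - 1) (j + 1) (k + 1) * T (s + 1) (j + 1) (k + 1) / (T s j (k + 1) * T s (j + 1) k), 0, 1)
     else unit2)"

definition stepXB :: "int \<Rightarrow> int \<Rightarrow> int \<Rightarrow> 'a mat2" where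
  "stepXB j k s = (if odd (s + j + k) then
     (1, T (s - 1) j k * T (s + 1) j k / (T s j (k + 1) * T s (j + 1) k), 0, 1)
     else unit2)"

abbreviation "move \<equiv> sweep [1..N - 1]"

text \<open>Two routes from row (j + 1, k) to row (j, k), through column (j + 1, k - 1) or column (j
  + 1, k). At sites with s + j + k even the equality of the matrix products is the T-relation at (s,
  j + 1, k).\<close>

lemma exchange_XA_Y:
  assumes "0 \<le> j"
  shows "move (stepXA j (k - 1)) (move (stepY (j + 1) (k - 1)) F) =
         move (stepY j k) (move (stepXB (j + 1) k) F)"
proof -
  have "mult2 (stepXA j (k - 1) s) (stepY (j + 1) (k - 1) s) = mult2 (stepY j k s) (stepXB (j + 1) k s)"
    if s: "1 \<le> s" "s < N" for s
  proof (cases "even (s + j + k)")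
    case True
    have nz: "T s j k \<noteq> 0" "T s (j + 1) (k - 1) \<noteq> 0" "T s (j + 1) (k + 1) \<noteq> 0" "T s (j + 2) k \<noteq> 0"
      by (rule T_nonzero; use s assms True in presburger)+
    have "T_relation T s (j + 1) k"
      using s assms True by (intro rel) auto
    then have R: "T s (j + 1) (k + 1) * T s (j + 1) (k - 1) =
        T s (j + 2) k * T s j k + T (s + 1) (j + 1) k * T (s - 1) (j + 1) k"
      by (simp add: T_relation_def add.assoc)
    define A B C D Q where defs: "A = T s j k" "B = T s (j + 1) (k - 1)" "C = T s (j + 1) (k + 1)"
      "D = T s (j + 2) k" "Q = T (s - 1) (j + 1) k * T (s + 1) (j + 1) k"
    have nz': "A \<noteq> 0" "B \<noteq> 0" "C \<noteq> 0" "D \<noteq> 0" using nz by (simp_all add: defs)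
    have Q: "Q = B * C - A * D" using R by (simp add: defs algebra_simps)
    have "mult2 (1, Q / (A * B), 0, 1) (D / B, 0, 1, 1 / (D / B)) =
          mult2 (C / A, 0, 1, 1 / (C / A)) (1, Q / (C * D), 0, 1)"
      unfolding Q using nz' by (simp add: field_simps)
    moreover have "stepXA j (k - 1) s = (1, Q / (A * B), 0, 1)"
      "stepY (j + 1) (k - 1) s = (D / B, 0, 1, 1 / (D / B))"
      "stepY j k s = (C / A, 0, 1, 1 / (C / A))" "stepXB (j + 1) k s = (1, Q / (C * D), 0, 1)"
      using True by (simp_all add: stepXA_def stepXB_def stepY_def ratio_def defs add.assoc)
    ultimately show ?thesis by (simp only:)
  next
    case False
    then have "even (s + j + (k - 1))" "odd (s + (j + 1) + (k - 1))" "even (s + (j + 1) + k)" by presburger+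
    then show ?thesis
      using False by (simp only: stepXA_def stepXB_def stepY_def if_False simp_thms)
  qed
  then have "move (\<lambda>s. mult2 (stepXA j (k - 1) s) (stepY (j + 1) (k - 1) s)) F =
             move (\<lambda>s. mult2 (stepY j k s) (stepXB (j + 1) k s)) F"
    by (intro sweep_cong) auto
  then show ?thesis
    by (subst (1 2) sweep_sweep[where q = "j + k"])
       (auto simp: stepXA_def stepXB_def stepY_def)
qed

text \<open>Two routes from column (j + 1, k) to column (j, k). Shears and \<open>stepY\<close> live
  on sites of opposite parity; pushing a shear through multiplies it by the ratios at both
  neighbours, which turns \<open>stepXB\<close> into \<open>stepXA\<close>.\<close>

lemma exchange_XB_Y:
  assumes "0 \<le> j"
  shows "move (stepXB j k) (move (stepY j k) F) = move (stepY j k) (move (stepXA j k) F)"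
proof -
  have "sweep ss (stepXB j k) (move (stepY j k) F) = move (stepY j k) (sweep ss (stepXA j k) F)"
    if "set ss \<subseteq> {1..N - 1}" for ss
    using that
  proof (induction ss)
    case (Cons s ss)
    have s: "1 \<le> s" "s < N" using Cons.prems by auto
    have "site_op s (stepXB j k s) (move (stepY j k) G) = move (stepY j k) (site_op s (stepXA j k s) G)" for G
    proof (cases "odd (s + j + k)")
      case True
      define c where "c = T (s - 1) j k * T (s + 1) j k / (T s j (k + 1) * T s (j + 1) k)"
      have nz: "T t j k \<noteq> 0" "T t (j + 1) (k + 1) \<noteq> 0" if "t = s - 1 \<or> t = s + 1" for t
        by (rule T_nonzero; use that s assms True in presburger)+
      \<comment> \<open>A neighbour 0 or \<open>N\<close> lies outside the sweep, but boundary
        values 1 make its ratio 1, so the product may run over both neighbours.\<close>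
      have bd: "ratio j k t = 1" if "t = s - 1 \<or> t = s + 1" "t \<notin> {1..N - 1}" for t
      proof -
        have "t = 0 \<or> t = N" using that s by auto
        moreover have "even (t + j + k)" using that True by auto
        ultimately have "T t j k = 1" "T t (j + 1) (k + 1) = 1"
          using assms T_bottom[of j k] T_bottom[of "j + 1" "k + 1"]
            T_top[of j k] T_top[of "j + 1" "k + 1"] by auto
        then show ?thesis by (simp add: ratio_def)
      qed
      have "(\<Prod>t\<in>{1..N - 1}. if \<bar>t - s\<bar> = 1 then ratio j k t else 1) =
            (\<Prod>t\<in>{s - 1, s + 1}. ratio j k t)"
        by (rule prod.mono_neutral_cong) (use bd in auto)
      also have "\<dots> = ratio j k (s - 1) * ratio j k (s + 1)" by simp
      finally have w: "c * (\<Prod>t\<in>set [1..N - 1]. if \<bar>t - s\<bar> = 1 then ratio j k t else 1) =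
          T (s - 1) (j + 1) (k + 1) * T (s + 1) (j + 1) (k + 1) / (T s j (k + 1) * T s (j + 1) k)"
        using nz by (simp add: c_def ratio_def)
      have "site_op s (1, c, 0, 1) (move (stepY j k) G) = move (stepY j k) (site_op s
          (1, c * (\<Prod>t\<in>set [1..N - 1]. if \<bar>t - s\<bar> = 1 then ratio j k t else 1), 0, 1) G)"
      proof (rule site_op_sweep_shear_commute)
        fix t assume "\<bar>t - s\<bar> = 1"
        then have t: "t = s - 1 \<or> t = s + 1" by linarith
        then show "ratio j k t \<noteq> 0 \<and> stepY j k t = (ratio j k t, 0, 1, 1 / ratio j k t)"
          using nz[OF t] True by (auto simp: stepY_def ratio_def)
      qed (use True in \<open>auto simp: stepY_def\<close>)
      then show ?thesis
        unfolding w using True by (simp add: stepXB_def stepXA_def c_def)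
    next
      case False
      then show ?thesis by (simp add: stepXB_def stepXA_def)
    qed
    then show ?case using Cons by simp
  qed simp
  then show ?thesis by auto
qed

text \<open>With wall values 1 and x = \<open>T s 1 k\<close>, this is the quotient of the shear (1,
  1/x, 0, 1) by the \<open>stepY\<close> matrix (x, 0, 1, 1/x). Its row (0, 1) only permutes
  indices; the row with -1 has to be avoided.\<close>

definition wall_flip :: "int \<Rightarrow> int \<Rightarrow> 'a mat2" where
  "wall_flip k s = (if odd (s + k) then (0, 1, - 1, T s 1 k) else unit2)"

lemma wall_exchange:
  "move (stepXB 0 k) F = move (wall_flip k) (move (stepY 0 (k - 1)) F)"
proof -
  have "stepXB 0 k s = mult2 (wall_flip k s) (stepY 0 (k - 1) s)" if s: "1 \<le> s" "s < N" for s
  proof (cases "odd (s + k)")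
    case True
    have "T s 1 k \<noteq> 0" using s True by (intro T_nonzero) auto
    then show ?thesis
      using s True by (auto simp: stepXB_def stepY_def wall_flip_def ratio_def T_wall)
  next
    case False
    then show ?thesis by (simp add: stepXB_def stepY_def wall_flip_def)
  qed
  then have "move (stepXB 0 k) F = move (\<lambda>s. mult2 (wall_flip k s) (stepY 0 (k - 1) s)) F"
    by (intro sweep_cong) auto
  then show ?thesis
    by (subst sweep_sweep[where q = "k - 1"]) (auto simp: stepY_def wall_flip_def)
qed


section \<open>Positivity along the initial surface\<close>

lemma init_all:
  assumes "0 \<le> s" "s \<le> N" "0 \<le> j" "even (s + j + k)" "k = m \<or> k = m + 1"
  shows "T s j k \<in> P" "inverse (T s j k) \<in> P"
proof -
  consider "s = 0" | "s = N" | "j = 0" | "1 \<le> s" "s < N" "1 \<le> j" using assms by linarith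
  then have "T s j k \<in> P \<and> inverse (T s j k) \<in> P"
  proof cases
    case 4
    then show ?thesis using assms init by blast
  qed (use assms in \<open>auto simp: T_bottom T_top T_wall P_one\<close>)
  then show "T s j k \<in> P" "inverse (T s j k) \<in> P" by auto
qed

lemma sweep_in_P:
  assumes "\<And>I. F I \<in> P"
    and "\<And>s. s \<in> set ss \<Longrightarrow> \<exists>a b c d. A s = (a, b, c, d) \<and> a \<in> P \<and> b \<in> P \<and> c \<in> P \<and> d \<in> P"
  shows "sweep ss A F I \<in> P"
  using assms(2)
proof (induction ss arbitrary: I)
  case (Cons s ss)
  obtain a b c d where "A s = (a, b, c, d)" "a \<in> P" "b \<in> P" "c \<in> P" "d \<in> P"
    using Cons.prems by (metis list.set_intros(1))
  then show ?case using Cons by (simp add: site_op.simps P_add P_mult)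
qed (use assms(1) in simp)

lemma move_init_in_P:
  assumes "0 \<le> j" and "\<And>I. F I \<in> P"
  shows "move (stepY j m) (move (stepXA j m) F) I \<in> P"
proof (intro sweep_in_P assms(2))
  fix s assume "s \<in> set [1..N - 1]"
  then have s: "1 \<le> s" "s < N" by auto
  show "\<exists>a b c d. stepXA j m s = (a, b, c, d) \<and> a \<in> P \<and> b \<in> P \<and> c \<in> P \<and> d \<in> P"
  proof (cases "odd (s + j + m)")
    case True
    have "T (s - 1) (j + 1) (m + 1) \<in> P" "T (s + 1) (j + 1) (m + 1) \<in> P"
      "inverse (T s j (m + 1)) \<in> P" "inverse (T s (j + 1) m) \<in> P"
      by (rule init_all; use s assms(1) True in presburger)+
    then show ?thesis
      using True P_zero P_one P_mult by (simp add: stepXA_def divide_inverse)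
  qed (use P_zero P_one in \<open>simp add: stepXA_def\<close>)
  show "\<exists>a b c d. stepY j m s = (a, b, c, d) \<and> a \<in> P \<and> b \<in> P \<and> c \<in> P \<and> d \<in> P"
  proof (cases "even (s + j + m)")
    case True
    have "T s (j + 1) (m + 1) \<in> P" "inverse (T s (j + 1) (m + 1)) \<in> P"
      "inverse (T s j m) \<in> P" "T s j m \<in> P"
      by (rule init_all; use s assms(1) True in presburger)+
    then show ?thesis
      using True P_zero P_one P_mult by (simp add: stepY_def ratio_def divide_inverse)
  qed (use P_zero P_one in \<open>simp add: stepY_def\<close>)
qed

section \<open>Transport of a multivector\<close>

definition block :: "int \<Rightarrow> int \<Rightarrow> bool" where
  "block i s \<longleftrightarrow> 1 \<le> s \<and> s \<le> i"

text \<open>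
  \<open>state i c n j\<close> holds the coefficients in the column \<open>(j, m + n)\<close> of the multivector that is
  the basis element \<open>block i\<close> in the column \<open>(c, m)\<close>; it is meaningful for \<open>j + n \<le> c\<close>.
\<close>

fun base_state :: "int \<Rightarrow> int \<Rightarrow> nat \<Rightarrow> (int \<Rightarrow> bool) \<Rightarrow> 'a" where
  "base_state i c 0 = (\<lambda>I. if I = block i then 1 else 0)"
| "base_state i c (Suc n) =
     move (stepY (c - 1 - int n) m) (move (stepXA (c - 1 - int n) m) (base_state i c n))"

fun state :: "int \<Rightarrow> int \<Rightarrow> nat \<Rightarrow> int \<Rightarrow> (int \<Rightarrow> bool) \<Rightarrow> 'a" where
  "state i c 0 j = base_state i c (nat (c - j))"
| "state i c (Suc n) j =
     move (stepXB j (m + 1 + int n)) (move (stepXA j (m + int n)) (state i c n (j + 1)))"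

lemma base_state_in_P:
  assumes "int n \<le> c"
  shows "base_state i c n I \<in> P"
  using assms
proof (induction n arbitrary: I)
  case (Suc n)
  then show ?case by (simp add: move_init_in_P)
qed (auto simp: P_zero P_one)

text \<open>Path independence: the antidiagonal moves defining \<open>state\<close> agree with the
  horizontal move from the right-hand neighbour, by one use of each exchange relation.\<close>

lemma state_column:
  assumes "0 \<le> j" "j + int n < c"
  shows "state i c n j = move (stepY j (m + int n)) (move (stepXA j (m + int n)) (state i c n (j + 1)))"
  using assms
proof (induction n arbitrary: j)
  case 0
  then have "nat (c - j) = Suc (nat (c - (j + 1)))" "c - 1 - int (nat (c - (j + 1))) = j" by auto
  then show ?case by simp
next
  case (Suc n)
  have "move (stepXA j (m + int n)) (state i c n (j + 1)) =
      move (stepXA j (m + 1 + int n - 1)) (move (stepY (j + 1) (m + 1 + int n - 1))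
        (move (stepXA (j + 1) (m + int n)) (state i c n (j + 1 + 1))))"
    using Suc by simp
  also have "\<dots> = move (stepY j (m + 1 + int n)) (state i c (Suc n) (j + 1))"
    using Suc.prems by (subst exchange_XA_Y) auto
  finally show ?case
    using Suc.prems exchange_XB_Y[of j "m + 1 + int n"] by (simp add: add_ac)
qed

text \<open>Flatness gives a path along the line where k - j is constant that uses only the lower
  triangular \<open>stepY\<close> moves.\<close>

lemma state_diagonal:
  assumes "0 \<le> j" "j + int n + 1 < c"
  shows "state i c n j =
    move (stepY j (m + int n)) (move (stepY j (m + 1 + int n)) (state i c (Suc n) (j + 1)))"
proof -
  have "move (stepXA j (m + int n)) (state i c n (j + 1)) =
      move (stepXA j (m + 1 + int n - 1)) (move (stepY (j + 1) (m + 1 + int n - 1))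
        (move (stepXA (j + 1) (m + int n)) (state i c n (j + 1 + 1))))"
    using assms state_column[of "j + 1" n c i] by simp
  also have "\<dots> = move (stepY j (m + 1 + int n)) (state i c (Suc n) (j + 1))"
    using assms by (subst exchange_XA_Y) auto
  finally show ?thesis using assms state_column[of j n c i] by simp
qed


section \<open>Block coefficients and conservation along diagonals\<close>

lemma site_op_block:
  assumes "1 \<le> s" "s \<noteq> i"
  shows "site_op s A F (block i) = F (block i)"
  using assms by (cases A) (auto simp: site_op.simps block_def)

lemma site_op_block_self:
  assumes "1 \<le> i"
  shows "site_op i (a, b, c, d) F (block i) = a * F (block i) + b * F (swap_bits i (block i))"
  using assms by (auto simp: site_op.simps block_def)

text \<open>Every site in the sweep other than i has both or neither of its indices in the block. At
  i the first matrix row is (ratio, 0), so no other coefficient enters.\<close>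

lemma move_Y_block:
  assumes "1 \<le> i" "i < N" "even (i + j + k)"
  shows "move (stepY j k) F (block i) = ratio j k i * F (block i)"
proof -
  have "sweep ss (stepY j k) F (block i) = (if i \<in> set ss then ratio j k i else 1) * F (block i)"
    if "distinct ss" "\<And>s. s \<in> set ss \<Longrightarrow> 1 \<le> s" for ss
    using that
  proof (induction ss)
    case (Cons s ss)
    then have "1 \<le> s" by auto
    then show ?case
      using Cons assms by (cases "s = i") (auto simp: stepY_def site_op_block site_op_block_self)
  qed simp
  from this[of "[1..N - 1]"] show ?thesis using assms by simp
qed

lemma move_Y_block_odd:
  assumes "odd (i + j + k)"
  shows "move (stepY j k) F (block i) = F (block i)"
proof -
  have "sweep ss (stepY j k) F (block i) = F (block i)"
    if "\<And>s. s \<in> set ss \<Longrightarrow> 1 \<le> s" for ss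
    using that
  proof (induction ss)
    case (Cons s ss)
    then have "1 \<le> s" by auto
    then show ?case
      using Cons assms by (cases "s = i") (auto simp: stepY_def site_op_block)
  qed simp
  from this[of "[1..N - 1]"] show ?thesis by simp
qed

text \<open>A shear feeds other coefficients only from sets containing s + 1 but not s, and a block
  is never such a set when s is at least 1.\<close>

lemma move_shear_delta:
  assumes "\<And>s. \<exists>c. A s = (1, c, 0, 1)"
  shows "move A (\<lambda>I. if I = block i then 1 else 0) = (\<lambda>I. if I = block i then 1 else 0)"
proof -
  have "sweep ss A (\<lambda>I. if I = block i then 1 else 0) = (\<lambda>I. if I = block i then 1 else 0)"
    if "\<And>s. s \<in> set ss \<Longrightarrow> 1 \<le> s" for ss
    using that
  proof (induction ss)
    case (Cons s ss)
    obtain c where A: "A s = (1, c, 0, 1)" using assms by blast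
    have "swap_bits s I \<noteq> block i" if "I s" "\<not> I (s + 1)" for I
    proof
      assume "swap_bits s I = block i"
      then have "block i (s + 1) = I s" "block i s = I (s + 1)"
        by (auto simp: swap_bits_apply dest: sym)
      then show False using that Cons.prems[of s] by (auto simp: block_def)
    qed
    then have "site_op s (1, c, 0, 1) (\<lambda>I. if I = block i then 1 else 0) I =
        (if I = block i then 1 else 0)" for I
      by (simp add: site_op.simps)
    then show ?case using Cons A by (simp add: fun_eq_iff[of "site_op _ _ _"])
  qed simp
  from this[of "[1..N - 1]"] show ?thesis by simp
qed

text \<open>A shear changes only coefficients of sets containing s but not s + 1, which does not
  occur for the top block when s < \<open>N\<close>.\<close>

lemma move_shear_top_block:
  assumes "\<And>s. \<exists>c. A s = (1, c, 0, 1)"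
  shows "move A F (\<lambda>s. N - i < s \<and> s \<le> N) = F (\<lambda>s. N - i < s \<and> s \<le> N)"
proof -
  have "sweep ss A F (\<lambda>s. N - i < s \<and> s \<le> N) = F (\<lambda>s. N - i < s \<and> s \<le> N)"
    if "\<And>s. s \<in> set ss \<Longrightarrow> s < N" for ss
    using that
  proof (induction ss)
    case (Cons s ss)
    obtain c where "A s = (1, c, 0, 1)" using assms by blast
    moreover have "s < N" "sweep ss A F (\<lambda>s. N - i < s \<and> s \<le> N) = F (\<lambda>s. N - i < s \<and> s \<le> N)"
      using Cons by simp_all
    ultimately show ?case by (auto simp: site_op.simps)
  qed simp
  from this[of "[1..N - 1]"] show ?thesis by simp
qed

lemma stepX_shear: "\<exists>c. stepXA j k s = (1, c, 0, 1)" "\<exists>c. stepXB j k s = (1, c, 0, 1)"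
  by (auto simp: stepXA_def stepXB_def)

lemma state_antidiagonal:
  "j + int n = c \<Longrightarrow> state i c n j = (\<lambda>I. if I = block i then 1 else 0)"
  by (induction n arbitrary: j) (simp_all add: move_shear_delta stepX_shear)

lemma state_top_block:
  "state i c n j (\<lambda>s. N - i < s \<and> s \<le> N) = state i c 0 (j + int n) (\<lambda>s. N - i < s \<and> s \<le> N)"
  by (induction n arbitrary: j) (simp_all add: move_shear_top_block stepX_shear add.assoc)

lemma state_in_P: "0 \<le> j \<Longrightarrow> j \<le> c \<Longrightarrow> state i c 0 j I \<in> P"
  by (simp add: base_state_in_P)

text \<open>Of the two \<open>stepY\<close> moves in a diagonal step, one is trivial at site i by
  parity and the other contributes the quotient of the two values of \<open>T\<close>.\<close>

lemma state_block_diagonal: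
  assumes "1 \<le> i" "i < N" "even (i + j + m + int n + 1)" "0 \<le> j" "j + int n + 1 < c"
  shows "T i j (m + int n + 1) * state i c n j (block i) =
         T i (j + 1) (m + int n + 2) * state i c (Suc n) (j + 1) (block i)"
proof -
  have "T i j (m + int n + 1) \<noteq> 0"
    by (rule T_nonzero; use assms in presburger)
  moreover have "state i c n j (block i) = ratio j (m + 1 + int n) i * state i c (Suc n) (j + 1) (block i)"
    using assms
    by (subst state_diagonal; (subst move_Y_block_odd)?; (subst move_Y_block)?; (auto simp del: state.simps)?)
  ultimately show ?thesis by (simp add: ratio_def add_ac del: state.simps)
qed

text \<open>The choice c = j + n puts column (j, m + n) on the antidiagonal of the starting point,
  where the block coefficient is 1; conservation is then iterated downwards.\<close>

lemma T_along_diagonal: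
  assumes "1 \<le> i" "i < N" "even (i + j + m + int n + 1)" "int d \<le> j" "d \<le> n"
  shows "T i j (m + int n + 1) =
         T i (j - int d) (m + int (n - d) + 1) * state i (j + int n) (n - d) (j - int d) (block i)"
  using assms(4,5)
proof (induction d)
  case 0
  then show ?case by (simp add: state_antidiagonal del: state.simps)
next
  case (Suc d)
  have n: "n - d = Suc (n - Suc d)" "int (n - d) = int n - int d" using Suc.prems by auto
  have "T i (j - int (Suc d)) (m + int (n - Suc d) + 1) *
      state i (j + int n) (n - Suc d) (j - int (Suc d)) (block i) =
      T i (j - int (Suc d) + 1) (m + int (n - Suc d) + 2) *
      state i (j + int n) (Suc (n - Suc d)) (j - int (Suc d) + 1) (block i)"
    using Suc.prems assms by (intro state_block_diagonal) auto
  then show ?case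
    using Suc n by (simp add: algebra_simps del: state.simps)
qed

section \<open>Descent along the wall\<close>

text \<open>
  Starting from \<open>{1..i}\<close> at \<open>n = 0\<close>, the wall step from \<open>n\<close> to \<open>n + 1\<close> moves every index \<open>s\<close> with
  \<open>s + i + n\<close> even one place up whenever \<open>s + 1\<close> is free.  The indices \<open>i\<close>, \<open>i - 1\<close>, ... start moving one after the
  other, advance in every later step and stop at the top end \<open>N\<close>: this is where the three
  alternatives come from.
\<close>

definition wall_config :: "int \<Rightarrow> int \<Rightarrow> int \<Rightarrow> bool" where
  "wall_config i n s \<longleftrightarrow> 1 \<le> s \<and> s \<le> N \<and>
     (s \<le> i - n \<or> 2 * N - i - n \<le> s \<or> even (s + i + n) \<and> n + 2 - i \<le> s \<and> s \<le> n + i)"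

lemma wall_config_0: "1 \<le> i \<Longrightarrow> i < N \<Longrightarrow> wall_config i 0 = block i"
  by (auto simp: wall_config_def block_def fun_eq_iff)

lemma wall_config_last: "1 \<le> i \<Longrightarrow> i < N \<Longrightarrow> wall_config i (N - 1) = (\<lambda>s. N - i < s \<and> s \<le> N)"
  by (auto simp: wall_config_def fun_eq_iff)

lemma wall_config_swap:
  assumes "1 \<le> i" "i < N" "0 \<le> n" "n + 1 < N" "even (s + i + n)" "0 \<le> s" "s \<le> N"
  shows "1 \<le> s \<Longrightarrow> s < N \<Longrightarrow> wall_config i (n + 1) s \<longleftrightarrow> wall_config i n (s + 1)"
    "1 \<le> s \<Longrightarrow> s < N \<Longrightarrow> wall_config i (n + 1) (s + 1) \<longleftrightarrow> wall_config i n s"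
    "s = 0 \<Longrightarrow> wall_config i (n + 1) 1 \<longleftrightarrow> wall_config i n 1"
    "s = N \<Longrightarrow> wall_config i (n + 1) N \<longleftrightarrow> wall_config i n N"
proof -
  obtain z where "s + i + n = 2 * z" using assms(5) by blast
  then have n: "n = 2 * z - s - i" by simp
  show "1 \<le> s \<Longrightarrow> s < N \<Longrightarrow> wall_config i (n + 1) s \<longleftrightarrow> wall_config i n (s + 1)"
    "1 \<le> s \<Longrightarrow> s < N \<Longrightarrow> wall_config i (n + 1) (s + 1) \<longleftrightarrow> wall_config i n s"
    using assms unfolding n wall_config_def by auto
  \<comment> \<open>An even number that is at least 1 is at least 2, an integrality step beyond
    linear arithmetic.\<close>
  have "1 \<le> 2 * i - 2 * z \<longleftrightarrow> 2 + (2 * z - 2 * i) \<le> 0" by presburger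
  then show "wall_config i (n + 1) 1 \<longleftrightarrow> wall_config i n 1" if "s = 0"
    using assms that unfolding n wall_config_def by auto
  show "wall_config i (n + 1) N \<longleftrightarrow> wall_config i n N" if "s = N"
    using assms that unfolding n wall_config_def by auto
qed

lemma wall_config_Suc:
  assumes "1 \<le> i" "i < N" "0 \<le> n" "n + 1 < N"
  shows "wall_config i (n + 1) =
    (\<lambda>t. if t \<in> set [1..N - 1] \<and> even (t + i + n) then wall_config i n (t + 1)
         else if t - 1 \<in> set [1..N - 1] \<and> even (t - 1 + i + n) then wall_config i n (t - 1)
         else wall_config i n t)"
proof (rule ext)
  fix t
  show "wall_config i (n + 1) t =
    (if t \<in> set [1..N - 1] \<and> even (t + i + n) then wall_config i n (t + 1)
     else if t - 1 \<in> set [1..N - 1] \<and> even (t - 1 + i + n) then wall_config i n (t - 1)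
     else wall_config i n t)"
  proof (cases "1 \<le> t \<and> t \<le> N")
    case False
    then show ?thesis by (auto simp: wall_config_def)
  next
    case t: True
    show ?thesis
    proof (cases "even (t + i + n)")
      case True
      then have "odd (t - 1 + i + n)" by presburger
      then show ?thesis
        using t True wall_config_swap(1,4)[OF assms True] by (cases "t = N") auto
    next
      case False
      then have "even (t - 1 + i + n)" by presburger
      then show ?thesis
        using t False wall_config_swap(2,3)[OF assms, of "t - 1"] by (cases "t = 1") auto
    qed
  qed
qed

text \<open>Provides the first hypothesis of \<open>sweep_swap\<close>, so the negative entry of
  \<open>wall_flip\<close> is never read.\<close>

lemma wall_config_no_ascent:
  assumes "1 \<le> i" "i < N" "0 \<le> n" "n + 1 < N" "1 \<le> s" "even (s + i + n)" "wall_config i n (s + 1)"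
  shows "wall_config i n s"
proof -
  obtain z where "s + i + n = 2 * z" using assms(6) by blast
  then have n: "n = 2 * z - s - i" by simp
  show ?thesis using assms unfolding n wall_config_def by auto
qed

text \<open>At the wall the last \<open>stepXB\<close> splits into \<open>stepY\<close>, which by
  \<open>state_column\<close> completes the state one level lower, and \<open>wall_flip\<close>,
  which here only permutes indices.\<close>

lemma state_wall:
  assumes "1 \<le> i" "i < N" "int n < c" "0 \<le> q" "q + 1 < N" "even (i + q + m + int n)"
  shows "state i c (Suc n) 0 (wall_config i q) = state i c n 0 (wall_config i (q + 1))"
proof -
  let ?F = "move (stepXA 0 (m + int n)) (state i c n 1)"
  have "state i c (Suc n) 0 = move (wall_flip (m + 1 + int n)) (move (stepY 0 (m + int n)) ?F)"
    using wall_exchange[of "m + 1 + int n" ?F] by simp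
  also have "move (stepY 0 (m + int n)) ?F = state i c n 0"
    using state_column[of 0 n c i] assms by simp
  finally have "state i c (Suc n) 0 (wall_config i q) =
      move (wall_flip (m + 1 + int n)) (state i c n 0) (wall_config i q)" by simp
  also have "\<dots> = state i c n 0 (wall_config i (q + 1))"
  proof (subst sweep_swap[where C = "\<lambda>s. even (s + i + q)" and c = "\<lambda>_. -1"
        and d = "\<lambda>s. T s 1 (m + 1 + int n)"])
    fix s
    have "odd (s + (m + 1 + int n)) \<longleftrightarrow> even (s + i + q)" using assms(6) by presburger
    then show "even (s + i + q) \<Longrightarrow> wall_flip (m + 1 + int n) s = (0, 1, -1, T s 1 (m + 1 + int n))"
      "odd (s + i + q) \<Longrightarrow> wall_flip (m + 1 + int n) s = unit2"
      by (auto simp: wall_flip_def)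
  qed (use assms wall_config_no_ascent wall_config_Suc in auto)
  finally show ?thesis .
qed

lemma state_wall_iterate:
  assumes "1 \<le> i" "i < N" "int n \<le> c" "even (i + m + int n + 1)" "d \<le> n" "int d < N"
  shows "state i c n 0 (block i) = state i c (n - d) 0 (wall_config i (int d))"
  using assms(5,6)
proof (induction d)
  case 0
  then show ?case using assms by (simp add: wall_config_0 del: state.simps)
next
  case (Suc d)
  have n: "n - d = Suc (n - Suc d)" using Suc.prems by auto
  have "state i c (Suc (n - Suc d)) 0 (wall_config i (int d)) =
      state i c (n - Suc d) 0 (wall_config i (int d + 1))"
    using assms Suc.prems by (intro state_wall) auto
  then show ?case using Suc n by (simp add: add.commute del: state.simps)
qed

section \<open>Positivity above the initial surface\<close>

theorem T_in_P_above:
  assumes "0 \<le> i" "i \<le> N" "0 \<le> j" "even (i + j + k)" "m \<le> k"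
  shows "T i j k \<in> P"
proof -
  consider "i = 0 \<or> i = N \<or> j = 0 \<or> k = m" | "1 \<le> i" "i < N" "1 \<le> j" "m < k"
    using assms by linarith
  then show ?thesis
  proof cases
    case 1
    then have "T i j k = 1 \<or> k = m"
      using assms T_bottom[of j k] T_top[of j k] T_wall[of i k] by fastforce
    then show ?thesis
      using assms init_all(1)[of i j k] P_one by metis
  next
    case 2
    \<comment> \<open>The target is the upper point of column (j, m + n); \<open>d\<close> counts
      the diagonal steps until height m + 1 or the wall is reached.\<close>
    define n where "n = nat (k - m - 1)"
    define d where "d = min n (nat j)"
    have k: "k = m + int n + 1" using 2 by (simp add: n_def)
    have par: "even (i + j + m + int n + 1)" using assms k by (simp add: add_ac)
    have T: "T i j k = T i (j - int d) (m + int (n - d) + 1) *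
        state i (j + int n) (n - d) (j - int d) (block i)"
      unfolding k using 2 par by (intro T_along_diagonal) (auto simp: d_def)
    show ?thesis
    proof (cases "int n \<le> j")
      case True
      then have d: "d = n" by (auto simp: d_def)
      have "T i (j - int d) (m + 1) \<in> P"
        by (rule init_all; use 2 True d par in presburger)
      moreover have "state i (j + int n) 0 (j - int d) (block i) \<in> P"
        using True d by (intro state_in_P) auto
      ultimately show ?thesis using T d P_mult by (simp del: state.simps)
    next
      case False
      then have d: "int d = j" using 2 by (auto simp: d_def)
      define n' where "n' = n - d"
      have n': "int n' = int n - j" using False d by (simp add: n'_def)
      have par': "even (i + m + int n' + 1)" using par n' by presburger
      have "T i 0 (m + int n' + 1) = 1" using 2 par' by (intro T_wall) (auto simp: add_ac)
      then have T': "T i j k = state i (j + int n) n' 0 (block i)"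
        using T d by (simp add: n'_def del: state.simps)
      show ?thesis
      proof (cases "int n' < N")
        case True
        have "state i (j + int n) n' 0 (block i) = state i (j + int n) (n' - n') 0 (wall_config i (int n'))"
          using 2 n' par' True by (intro state_wall_iterate) auto
        then show ?thesis using T' 2 state_in_P[of 0 "j + int n"] by (simp del: state.simps)
      next
        case False
        \<comment> \<open>After N - 1 wall steps the configuration is the top block, whose
          coefficient is constant along the antidiagonal; this covers the remaining n' - e
          levels.\<close>
        define e where "e = nat (N - 1)"
        have e: "int e = N - 1" using N by (simp add: e_def)
        have "state i (j + int n) n' 0 (block i) = state i (j + int n) (n' - e) 0 (wall_config i (int e))"
          using 2 n' par' False e by (intro state_wall_iterate) auto
        also have "\<dots> = state i (j + int n) 0 (int (n' - e)) (\<lambda>s. N - i < s \<and> s \<le> N)"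
          using 2 e state_top_block[of i "j + int n" "n' - e" 0] by (simp add: wall_config_last del: state.simps)
        also have "\<dots> \<in> P" using n' 2 by (intro state_in_P) auto
        finally show ?thesis using T' by simp
      qed
    qed
  qed
qed

end

section \<open>Rational functions and Laurent polynomials\<close>

definition nonneg_coeffs :: "int_mpoly \<Rightarrow> bool" where
  "nonneg_coeffs p \<longleftrightarrow> (\<forall>e. 0 \<le> Poly_Mapping.lookup p e)"

text \<open>The instance of \<open>Q\<close> in \<open>T_in_semifield_above\<close>: sums of
  nonnegative coefficients cannot cancel, so 0 is never produced.\<close>

definition pos_ratfuns :: "ratfun set" where
  "pos_ratfuns = {Fract p q | p q. p \<noteq> 0 \<and> q \<noteq> 0 \<and> nonneg_coeffs p \<and> nonneg_coeffs q}"

lemma nonneg_coeffs_add: "nonneg_coeffs p \<Longrightarrow> nonneg_coeffs q \<Longrightarrow> nonneg_coeffs (p + q)"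
  by (simp add: nonneg_coeffs_def lookup_add)

lemma nonneg_coeffs_mult: "nonneg_coeffs p \<Longrightarrow> nonneg_coeffs q \<Longrightarrow> nonneg_coeffs (p * q)"
  by (auto simp: nonneg_coeffs_def lookup_mult Sum_any.expand_set when_def intro!: sum_nonneg mult_nonneg_nonneg)

lemma nonneg_coeffs_add_nonzero:
  assumes "nonneg_coeffs p" "nonneg_coeffs q" "p \<noteq> 0"
  shows "p + q \<noteq> 0"
proof
  assume eq: "p + q = 0"
  have "Poly_Mapping.lookup p e = 0" for e
  proof -
    have "Poly_Mapping.lookup p e + Poly_Mapping.lookup q e = 0"
      using arg_cong[OF eq, of "\<lambda>f. Poly_Mapping.lookup f e"] by (simp add: lookup_add)
    then show ?thesis using assms(1,2) by (metis add_nonneg_eq_0_iff nonneg_coeffs_def)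
  qed
  then show False using assms(3) by (auto intro: poly_mapping_eqI)
qed

lemma pos_ratfunsI:
  "p \<noteq> 0 \<Longrightarrow> q \<noteq> 0 \<Longrightarrow> nonneg_coeffs p \<Longrightarrow> nonneg_coeffs q \<Longrightarrow> Fract p q \<in> pos_ratfuns"
  unfolding pos_ratfuns_def by blast

lemma pos_ratfunsE:
  assumes "x \<in> pos_ratfuns"
  obtains p q where "x = Fract p q" "p \<noteq> 0" "q \<noteq> 0" "nonneg_coeffs p" "nonneg_coeffs q"
  using assms unfolding pos_ratfuns_def by blast

lemma pos_ratfuns_add: "x \<in> pos_ratfuns \<Longrightarrow> y \<in> pos_ratfuns \<Longrightarrow> x + y \<in> pos_ratfuns"
  by (elim pos_ratfunsE)
     (simp add: pos_ratfunsI nonneg_coeffs_add_nonzero nonneg_coeffs_add nonneg_coeffs_mult)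

lemma pos_ratfuns_mult: "x \<in> pos_ratfuns \<Longrightarrow> y \<in> pos_ratfuns \<Longrightarrow> x * y \<in> pos_ratfuns"
  by (elim pos_ratfunsE) (simp add: pos_ratfunsI nonneg_coeffs_mult)

lemma pos_ratfuns_divide: "x \<in> pos_ratfuns \<Longrightarrow> y \<in> pos_ratfuns \<Longrightarrow> x / y \<in> pos_ratfuns"
  by (elim pos_ratfunsE) (simp add: pos_ratfunsI nonneg_coeffs_mult)

lemma zero_notin_pos_ratfuns: "0 \<notin> pos_ratfuns"
  by (auto simp: pos_ratfuns_def Zero_fract_def eq_fract)

lemma nonneg_coeffs_single: "0 \<le> c \<Longrightarrow> nonneg_coeffs (Poly_Mapping.single e c)"
  by (simp add: nonneg_coeffs_def lookup_single when_def)

lemma nonneg_coeffs_one: "nonneg_coeffs 1"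
  using nonneg_coeffs_single[of 1 0] by simp

lemma one_in_pos_ratfuns: "1 \<in> pos_ratfuns"
  unfolding One_fract_def by (simp add: pos_ratfunsI nonneg_coeffs_one)

lemma single_one_nonzero: "Poly_Mapping.single e (1::int) \<noteq> 0"
  by (metis lookup_single_eq lookup_zero zero_neq_one)

lemma tvar_in_pos_ratfuns: "tvar i j \<in> pos_ratfuns"
  unfolding tvar_def
  by (simp add: pos_ratfunsI nonneg_coeffs_one nonneg_coeffs_single single_one_nonzero)

lemma tvar_nonzero: "tvar i j \<noteq> 0"
  using tvar_in_pos_ratfuns zero_notin_pos_ratfuns by metis

section \<open>The semiring of non-negative Laurent polynomials\<close>

definition laurent_value :: "(((int \<times> int) \<Rightarrow>\<^sub>0 int) \<Rightarrow>\<^sub>0 int) \<Rightarrow> ratfun" where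
  "laurent_value c = (\<Sum>e\<in>Poly_Mapping.keys c. of_int (Poly_Mapping.lookup c e) * laurent_monom e)"

lemma laurent_monom_superset:
  assumes "finite S" "Poly_Mapping.keys e \<subseteq> S"
  shows "laurent_monom e = (\<Prod>(i, j)\<in>S. tvar i j powi Poly_Mapping.lookup e (i, j))"
  unfolding laurent_monom_def using assms
  by (intro prod.mono_neutral_left) (auto simp: in_keys_iff)

lemma laurent_monom_add: "laurent_monom (e + e') = laurent_monom e * laurent_monom e'"
proof -
  let ?S = "Poly_Mapping.keys e \<union> Poly_Mapping.keys e'"
  have "laurent_monom (e + e') = (\<Prod>(i, j)\<in>?S. tvar i j powi Poly_Mapping.lookup (e + e') (i, j))"
    using keys_add[of e e'] by (intro laurent_monom_superset) auto
  also have "\<dots> = (\<Prod>(i, j)\<in>?S. tvar i j powi Poly_Mapping.lookup e (i, j)) *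
      (\<Prod>(i, j)\<in>?S. tvar i j powi Poly_Mapping.lookup e' (i, j))"
    by (simp add: prod.distrib[symmetric] case_prod_unfold lookup_add power_int_add tvar_nonzero)
  also have "\<dots> = laurent_monom e * laurent_monom e'"
    by (subst (1 2) laurent_monom_superset[where S = ?S]) auto
  finally show ?thesis .
qed

lemma laurent_value_superset:
  assumes "finite S" "Poly_Mapping.keys c \<subseteq> S"
  shows "laurent_value c = (\<Sum>e\<in>S. of_int (Poly_Mapping.lookup c e) * laurent_monom e)"
  unfolding laurent_value_def using assms
  by (intro sum.mono_neutral_left) (auto simp: in_keys_iff)

lemma laurent_value_add: "laurent_value (c + d) = laurent_value c + laurent_value d"
proof -
  let ?S = "Poly_Mapping.keys c \<union> Poly_Mapping.keys d"
  have "laurent_value (c + d) = (\<Sum>e\<in>?S. of_int (Poly_Mapping.lookup (c + d) e) * laurent_monom e)"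
    using keys_add[of c d] by (intro laurent_value_superset) auto
  also have "\<dots> = (\<Sum>e\<in>?S. of_int (Poly_Mapping.lookup c e) * laurent_monom e) +
      (\<Sum>e\<in>?S. of_int (Poly_Mapping.lookup d e) * laurent_monom e)"
    by (simp add: sum.distrib[symmetric] lookup_add algebra_simps)
  also have "\<dots> = laurent_value c + laurent_value d"
    by (subst (1 2) laurent_value_superset[where S = ?S]) auto
  finally show ?thesis .
qed

lemma nonneg_laurent_polyI:
  assumes "\<And>e. e \<in> Poly_Mapping.keys c \<Longrightarrow> Poly_Mapping.keys e \<subseteq> V"
    and "\<And>e. 0 \<le> Poly_Mapping.lookup c e" and "f = laurent_value c"
  shows "nonneg_laurent_poly V f"
  unfolding nonneg_laurent_poly_def laurent_value_def[symmetric] using assms by blast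

lemma nonneg_laurent_polyE:
  assumes "nonneg_laurent_poly V f"
  obtains c where "\<forall>e\<in>Poly_Mapping.keys c. Poly_Mapping.keys e \<subseteq> V"
    and "\<forall>e. 0 \<le> Poly_Mapping.lookup c e" and "f = laurent_value c"
  using assms unfolding nonneg_laurent_poly_def laurent_value_def[symmetric] by blast

lemma nonneg_laurent_poly_0: "nonneg_laurent_poly V 0"
  by (rule nonneg_laurent_polyI[where c = 0]) (auto simp: laurent_value_def)

lemma nonneg_laurent_poly_add:
  assumes "nonneg_laurent_poly V f" "nonneg_laurent_poly V g"
  shows "nonneg_laurent_poly V (f + g)"
proof -
  obtain c where c: "\<forall>e\<in>Poly_Mapping.keys c. Poly_Mapping.keys e \<subseteq> V"
    "\<forall>e. 0 \<le> Poly_Mapping.lookup c e" "f = laurent_value c" using assms(1) by (rule nonneg_laurent_polyE)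
  obtain d where d: "\<forall>e\<in>Poly_Mapping.keys d. Poly_Mapping.keys e \<subseteq> V"
    "\<forall>e. 0 \<le> Poly_Mapping.lookup d e" "g = laurent_value d" using assms(2) by (rule nonneg_laurent_polyE)
  show ?thesis
  proof (rule nonneg_laurent_polyI)
    show "f + g = laurent_value (c + d)" using c d by (simp add: laurent_value_add)
    show "Poly_Mapping.keys e \<subseteq> V" if "e \<in> Poly_Mapping.keys (c + d)" for e
      using that keys_add[of c d] c(1) d(1) by blast
    show "0 \<le> Poly_Mapping.lookup (c + d) e" for e using c(2) d(2) by (simp add: lookup_add)
  qed
qed

lemma nonneg_laurent_poly_sum:
  assumes "\<And>x. x \<in> A \<Longrightarrow> nonneg_laurent_poly V (f x)"
  shows "nonneg_laurent_poly V (\<Sum>x\<in>A. f x)"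
  using assms by (induction A rule: infinite_finite_induct)
    (auto intro: nonneg_laurent_poly_0 nonneg_laurent_poly_add)

lemma nonneg_laurent_poly_monom:
  assumes "Poly_Mapping.keys e \<subseteq> V" "0 \<le> n"
  shows "nonneg_laurent_poly V (of_int n * laurent_monom e)"
proof (rule nonneg_laurent_polyI[where c = "Poly_Mapping.single e n"])
  show "of_int n * laurent_monom e = laurent_value (Poly_Mapping.single e n)"
    by (cases "n = 0") (simp_all add: laurent_value_def)
qed (use assms in \<open>auto simp: lookup_single when_def split: if_splits\<close>)

lemma nonneg_laurent_poly_mult:
  assumes "nonneg_laurent_poly V f" "nonneg_laurent_poly V g"
  shows "nonneg_laurent_poly V (f * g)"
proof -
  obtain c where c: "\<forall>e\<in>Poly_Mapping.keys c. Poly_Mapping.keys e \<subseteq> V"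
    "\<forall>e. 0 \<le> Poly_Mapping.lookup c e" "f = laurent_value c" using assms(1) by (rule nonneg_laurent_polyE)
  obtain d where d: "\<forall>e\<in>Poly_Mapping.keys d. Poly_Mapping.keys e \<subseteq> V"
    "\<forall>e. 0 \<le> Poly_Mapping.lookup d e" "g = laurent_value d" using assms(2) by (rule nonneg_laurent_polyE)
  have "f * g = (\<Sum>e\<in>Poly_Mapping.keys c. \<Sum>e'\<in>Poly_Mapping.keys d.
      of_int (Poly_Mapping.lookup c e * Poly_Mapping.lookup d e') * laurent_monom (e + e'))"
    unfolding c d laurent_value_def sum_product by (simp add: laurent_monom_add mult_ac)
  also have "nonneg_laurent_poly V \<dots>"
  proof (intro nonneg_laurent_poly_sum nonneg_laurent_poly_monom)
    fix e e' assume "e \<in> Poly_Mapping.keys c" "e' \<in> Poly_Mapping.keys d"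
    then show "Poly_Mapping.keys (e + e') \<subseteq> V" using keys_add[of e e'] c(1) d(1) by blast
  qed (use c d in auto)
  finally show ?thesis .
qed

lemma nonneg_laurent_poly_tvar_powi:
  assumes "(i, j) \<in> V"
  shows "nonneg_laurent_poly V (tvar i j powi n)"
proof -
  have "tvar i j powi n = of_int 1 * laurent_monom (Poly_Mapping.single (i, j) n)"
    by (cases "n = 0") (simp_all add: laurent_monom_def)
  then show ?thesis
    using nonneg_laurent_poly_monom[of "Poly_Mapping.single (i, j) n" V 1] assms
    by (auto split: if_splits)
qed

lemma nonneg_laurent_poly_1: "nonneg_laurent_poly V 1"
  using nonneg_laurent_poly_monom[of 0 V 1] by (simp add: laurent_monom_def)

text \<open>Heights below m are treated in the reflected system. The surface heights m and m + 1
  become -m and -m - 1, so its base height is -m - 1.\<close>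

lemma half_space_nonneg_laurent:
  fixes T :: "int \<Rightarrow> int \<Rightarrow> int \<Rightarrow> ratfun"
  assumes "half_space_system N T"
    and init: "\<And>s j k. 1 \<le> s \<Longrightarrow> s < N \<Longrightarrow> 1 \<le> j \<Longrightarrow> even (s + j + k) \<Longrightarrow> k = m \<or> k = m + 1 \<Longrightarrow>
      \<exists>a b. (a, b) \<in> V \<and> T s j k = tvar a b"
    and "0 \<le> s" "s \<le> N" "0 \<le> j" "even (s + j + k)"
  shows "nonneg_laurent_poly V (T s j k)"
proof -
  let ?T' = "\<lambda>s j k. T s j (- k)"
  have sys': "half_space_system N ?T'" using assms(1) by (rule half_space_system.reflect)
  have init': "\<exists>a b. (a, b) \<in> V \<and> ?T' s j k = tvar a b"
    if "1 \<le> s" "s < N" "1 \<le> j" "even (s + j + k)" "k = - m - 1 \<or> k = - m - 1 + 1" for s j k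
    using that by (intro init) auto
  note closed = one_in_pos_ratfuns pos_ratfuns_add pos_ratfuns_mult pos_ratfuns_divide
    zero_notin_pos_ratfuns
  have above: "T s j k \<in> pos_ratfuns" if "0 \<le> s" "s \<le> N" "0 \<le> j" "even (s + j + k)" "m \<le> k" for s j k
  proof (rule half_space_system.T_in_semifield_above[OF assms(1) closed _ that])
    fix s j k :: int
    assume "1 \<le> s" "s < N" "1 \<le> j" "even (s + j + k)" "k = m \<or> k = m + 1"
    then show "T s j k \<in> pos_ratfuns" using init tvar_in_pos_ratfuns by metis
  qed
  have below: "?T' s j k \<in> pos_ratfuns"
    if "0 \<le> s" "s \<le> N" "0 \<le> j" "even (s + j + k)" "- m - 1 \<le> k" for s j k
  proof (rule half_space_system.T_in_semifield_above[OF sys' closed _ that])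
    fix s j k :: int
    assume "1 \<le> s" "s < N" "1 \<le> j" "even (s + j + k)" "k = - m - 1 \<or> k = - m - 1 + 1"
    then show "?T' s j k \<in> pos_ratfuns" using init' tvar_in_pos_ratfuns by metis
  qed
  have nz: "T s j k \<noteq> 0" if "0 \<le> s" "s \<le> N" "0 \<le> j" "even (s + j + k)" for s j k
  proof (cases "m \<le> k")
    case True
    then show ?thesis using above[OF that] zero_notin_pos_ratfuns by auto
  next
    case False
    then show ?thesis using below[of s j "- k"] that zero_notin_pos_ratfuns by auto
  qed
  let ?P = "Collect (nonneg_laurent_poly V)"
  have tv: "x \<in> ?P \<and> inverse x \<in> ?P" if x: "\<exists>a b. (a, b) \<in> V \<and> x = tvar a b" for x
  proof -
    obtain a b where "(a, b) \<in> V" "x = tvar a b" using x by blast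
    then show ?thesis
      using nonneg_laurent_poly_tvar_powi[of a b V 1] nonneg_laurent_poly_tvar_powi[of a b V "- 1"]
      by (simp add: power_int_minus)
  qed
  note P = nonneg_laurent_poly_0 nonneg_laurent_poly_1 nonneg_laurent_poly_add nonneg_laurent_poly_mult
  have hs: "half_space N T m ?P"
    by (rule half_space.intro[OF assms(1)], unfold_locales) (use nz tv init P in auto)
  have hs': "half_space N ?T' (- m - 1) ?P"
    by (rule half_space.intro[OF sys'], unfold_locales) (use nz tv init' P in auto)
  show ?thesis
  proof (cases "m \<le> k")
    case True
    then show ?thesis using half_space.T_in_P_above[OF hs] assms by simp
  next
    case False
    then show ?thesis using half_space.T_in_P_above[OF hs', of s j "- k"] assms by simp
  qed
qed

theorem theorem5p9:
  fixes r l :: int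
  assumes "r \<ge> 1" and "l \<ge> 1"
  shows "(\<forall>T. right_half_space_solution r T \<longrightarrow>
            (\<forall>i\<in>{0..r + 1}. \<forall>j\<ge>0. \<forall>k. even (i + j + k) \<longrightarrow>
               nonneg_laurent_poly ({1..r} \<times> {1..}) (T i j k)))
       \<and> (\<forall>T. left_half_space_solution r l T \<longrightarrow>
            (\<forall>i\<in>{0..r + 1}. \<forall>j\<le>l + 1. \<forall>k. even (i + j + k) \<longrightarrow>
               nonneg_laurent_poly ({1..r} \<times> {..l}) (T i j k)))"
proof (intro conjI allI impI ballI)
  fix T i j k
  assume T: "right_half_space_solution r T" and ijk: "i \<in> {0..r + 1}" "0 \<le> j" "even (i + j + k)"
  have "half_space_system (r + 1) T"
    using T assms(1) by unfold_locales (auto simp: right_half_space_solution_def)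
  moreover have "\<exists>a b. (a, b) \<in> {1..r} \<times> {1..} \<and> T s j k = tvar a b"
    if "1 \<le> s" "s < r + 1" "1 \<le> j" "even (s + j + k)" "k = 0 \<or> k = 0 + 1" for s j k
  proof -
    have "k = k0 s j" unfolding k0_def using that by presburger
    then have "T s j k = tvar s j" using T that by (simp add: right_half_space_solution_def)
    moreover have "(s, j) \<in> {1..r} \<times> {1..}" using that by simp
    ultimately show ?thesis by blast
  qed
  ultimately show "nonneg_laurent_poly ({1..r} \<times> {1..}) (T i j k)"
    using half_space_nonneg_laurent[of "r + 1" T 0] ijk by simp
next
  fix T i j k
  assume T: "left_half_space_solution r l T" and ijk: "i \<in> {0..r + 1}" "j \<le> l + 1" "even (i + j + k)"
  \<comment> \<open>The height shift by l + 1 compensates the parity change caused by reflecting j,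
    so the initial surface of \<open>U\<close> starts at height -(l + 1).\<close>
  define U where "U = (\<lambda>s j k. T s (l + 1 - j) (k + (l + 1)))"
  have "half_space_system (r + 1) U"
  proof
    fix s j k :: int
    assume "1 \<le> s" "s < r + 1" "1 \<le> j" "odd (s + j + k)"
    moreover from this have "odd (s + (l + 1 - j) + (k + (l + 1)))" by presburger
    ultimately have "T_relation T s (l + 1 - j) (k + (l + 1))"
      using T by (auto simp: left_half_space_solution_def)
    then show "T_relation U s j k"
      by (simp add: T_relation_def U_def algebra_simps)
  next
    fix j k :: int assume "0 \<le> j" "even (j + k)"
    moreover from this have "even (0 + (l + 1 - j) + (k + (l + 1)))" by presburger
    ultimately show "U 0 j k = 1" using T by (auto simp: left_half_space_solution_def U_def)
  next
    fix j k :: int assume "0 \<le> j" "even (r + 1 + j + k)"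
    moreover from this have "even (r + 1 + (l + 1 - j) + (k + (l + 1)))" by presburger
    ultimately show "U (r + 1) j k = 1" using T by (auto simp: left_half_space_solution_def U_def)
  next
    fix s k :: int assume "0 \<le> s" "s \<le> r + 1" "even (s + k)"
    moreover from this have "even (s + (l + 1) + (k + (l + 1)))" by presburger
    ultimately show "U s 0 k = 1" using T by (auto simp: left_half_space_solution_def U_def)
  qed (use assms in auto)
  moreover have "\<exists>a b. (a, b) \<in> {1..r} \<times> {..l} \<and> U s j k = tvar a b"
    if "1 \<le> s" "s < r + 1" "1 \<le> j" "even (s + j + k)" "k = - (l + 1) \<or> k = - (l + 1) + 1" for s j k
  proof -
    have "k + (l + 1) = k0 s (l + 1 - j)" unfolding k0_def using that by presburger
    then have "U s j k = tvar s (l + 1 - j)"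
      using T that by (simp add: left_half_space_solution_def U_def)
    moreover have "(s, l + 1 - j) \<in> {1..r} \<times> {..l}" using that by simp
    ultimately show ?thesis by blast
  qed
  moreover have "even (i + (l + 1 - j) + (k - (l + 1)))" using ijk by presburger
  ultimately have "nonneg_laurent_poly ({1..r} \<times> {..l}) (U i (l + 1 - j) (k - (l + 1)))"
    using ijk by (intro half_space_nonneg_laurent[where m = "- (l + 1)" and N = "r + 1"]) auto
  then show "nonneg_laurent_poly ({1..r} \<times> {..l}) (T i j k)" by (simp add: U_def)
qed

end
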